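(* Let $f$ be a multiplicative arithmetic function, $p$ a prime, $m\ge0$ an integer and $N\ge1$ an integer. Then $$F\{f;N,p^m\}=\sum_{r=0}^{\lfloor\log_p N\rfloor}L_r(f;p^m)\,F\left\{f;\left\lfloor\frac{N}{p^r}\right\rfloor,1\right\},$$ where the numbers $L_r(f;p^m)$ are defined recursively by $L_0(f;p^m)=f(p^m)$ and $$L_r(f;p^m)=f(p^{m+r})-\sum_{j=0}^{r-1}L_j(f;p^m)f(p^{r-j}),\qquad r\ge1.$$
   Context: An arithmetic function $f:\mathbb{Z}_{>0}\to\mathbb{R}$ is multiplicative if $f(1)=1$ and $f(k_1k_2)=f(k_1)f(k_2)$ whenever $\gcd(k_1,k_2)=1$. For a positive integer $q$ put $F\{f;N,q\}=\sum_{k\le N}f(qk)$ (sum over positive integers $k\le N$); in particular $F\{f;N,1\}=\sum_{k\le N}f(k)$. $\lfloor u\rfloor$ is the largest integer not exceeding $u$. *)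

theory Defs
  imports Complex_Main "HOL-Computational_Algebra.Primes"
begin

(* Arithmetic functions are modelled on nat; the value at 0 is unconstrained and never used. *)
definition multiplicative :: "(nat \<Rightarrow> real) \<Rightarrow> bool" where
  "multiplicative f \<longleftrightarrow>
     f 1 = 1 \<and> (\<forall>k1 > 0. \<forall>k2 > 0. coprime k1 k2 \<longrightarrow> f (k1 * k2) = f k1 * f k2)"

definition F :: "(nat \<Rightarrow> real) \<Rightarrow> nat \<Rightarrow> nat \<Rightarrow> real" where
  "F f N q = (\<Sum>k = 1..N. f (q * k))"

(* L f p m r stands for L_r(f; p^m); p and m are separate arguments because the recursion
   uses the base p itself, which p^m does not determine when m = 0. *)
fun L :: "(nat \<Rightarrow> real) \<Rightarrow> nat \<Rightarrow> nat \<Rightarrow> nat \<Rightarrow> real" where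
  "L f p m 0 = f (p ^ m)"
| "L f p m (Suc r) = f (p ^ (m + Suc r)) - (\<Sum>j = 0..r. L f p m j * f (p ^ (Suc r - j)))"

end

theory Submission
  imports Defs
begin

text \<open>The recursion for \<open>L\<close> says that the convolution of \<open>r \<mapsto> L\<^sub>r(f;p\<^sup>m)\<close> with \<open>r \<mapsto> f(p\<^sup>r)\<close> is
  \<open>r \<mapsto> f(p\<^sup>m\<^sup>+\<^sup>r)\<close>. Multiplying by the value of \<open>f\<close> at the \<open>p\<close>-free part of \<open>n\<close> turns this into
  a formula for \<open>f(p\<^sup>m n)\<close> as a sum over the powers of \<open>p\<close> dividing \<open>n\<close>; summing over \<open>n \<le> N\<close> and
  exchanging the two summations gives the result.\<close>

lemma multiplicative_prime_power_times:
  assumes "multiplicative f" "prime p" "\<not> p dvd k"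
  shows "f (p ^ a * k) = f (p ^ a) * f k"
proof -
  have "coprime (p ^ a) k"
    using assms(2,3) by (simp add: prime_imp_coprime)
  moreover have "k > 0"
    using assms(3) by (auto intro: Nat.gr0I)
  ultimately show ?thesis
    using assms(1,2) by (simp add: multiplicative_def prime_gt_0_nat)
qed

text \<open>The term \<open>j = s\<close> equals \<open>L f p m s\<close> because
  \<open>f 1 = 1\<close>; the remaining terms are exactly the sum that the recursion
  subtracts.\<close>

lemma sum_L_convolution:
  assumes "multiplicative f"
  shows "(\<Sum>j = 0..s. L f p m j * f (p ^ (s - j))) = f (p ^ (m + s))"
  using assms by (cases s) (simp_all add: multiplicative_def)

lemma multiplicative_prime_power_expansion:
  assumes f: "multiplicative f" and p: "prime p" and "n > 0"
  shows "f (p ^ m * n) = (\<Sum>r = 0..multiplicity p n. L f p m r * f (n div p ^ r))"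
proof -
  define s where "s = multiplicity p n"
  obtain k where n: "n = p ^ s * k" and k: "\<not> p dvd k"
    using multiplicity_decompose'[of n p] assms unfolding s_def
    by (metis neq0_conv not_prime_unit)
  \<comment> \<open>For \<open>r\<close> \<le> \<open>s\<close>, dividing \<open>n\<close> by
    \<open>p ^ r\<close> only lowers the exponent of \<open>p\<close>, so the \<open>p\<close>-free
    part \<open>k\<close> contributes the same factor \<open>f k\<close> to every term.\<close>
  have "(\<Sum>r = 0..s. L f p m r * f (n div p ^ r))
      = (\<Sum>r = 0..s. L f p m r * f (p ^ (s - r)) * f k)"
  proof (rule sum.cong[OF refl])
    fix r assume "r \<in> {0..s}"
    then have "n = p ^ r * (p ^ (s - r) * k)"
      by (simp add: n flip: power_add mult.assoc)
    then have "n div p ^ r = p ^ (s - r) * k"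
      using p by (metis nonzero_mult_div_cancel_left not_prime_0 power_not_zero)
    then show "L f p m r * f (n div p ^ r) = L f p m r * f (p ^ (s - r)) * f k"
      using multiplicative_prime_power_times[OF f p k] by simp
  qed
  also have "\<dots> = f (p ^ (m + s)) * f k"
    by (simp add: sum_L_convolution[OF f] flip: sum_distrib_right)
  also have "\<dots> = f (p ^ m * n)"
    using multiplicative_prime_power_times[OF f p k, of "m + s"]
    by (simp add: n power_add mult.assoc)
  finally show ?thesis
    by (simp add: s_def)
qed

text \<open>Division by \<open>d\<close> maps the multiples of \<open>d\<close> in
  \<open>{1..N}\<close> bijectively onto \<open>{1..N div d}\<close>, with inverse multiplication by
  \<open>d\<close>.\<close>

lemma sum_over_multiples:
  fixes g :: "nat \<Rightarrow> 'a :: comm_monoid_add" and d N :: nat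
  assumes "d > 0"
  shows "(\<Sum>n | n \<in> {1..N} \<and> d dvd n. g (n div d)) = (\<Sum>k = 1..N div d. g k)"
proof (rule sum.reindex_bij_witness[of _ "\<lambda>k. d * k" "\<lambda>n. n div d"])
  fix n assume n: "n \<in> {n. n \<in> {1..N} \<and> d dvd n}"
  then show "d * (n div d) = n"
    by simp
  show "n div d \<in> {1..N div d}"
    using n assms by (auto simp: div_le_mono div_greater_zero_iff Suc_le_eq dvd_imp_le)
next
  fix k assume "k \<in> {1..N div d}"
  then show "d * k \<in> {n. n \<in> {1..N} \<and> d dvd n}"
    using assms by (auto simp: less_eq_div_iff_mult_less_eq mult.commute Suc_le_eq)
qed (use assms in auto)

lemma le_nat_floor_log:
  fixes b n r :: nat
  assumes "b > 1" "b ^ r \<le> n"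
  shows "r \<le> nat \<lfloor>log (real b) (real n)\<rfloor>"
proof -
  have "real r \<le> log (real b) (real n)"
    using assms by (intro le_log_of_power) (simp_all flip: of_nat_power)
  then show ?thesis
    by (simp add: le_nat_floor)
qed

theorem mainTheorem4:
  fixes f :: "nat \<Rightarrow> real" and p m N :: nat
  assumes "multiplicative f" and "prime p" and "N \<ge> 1"
  shows "F f N (p ^ m) =
    (\<Sum>r = 0..nat \<lfloor>log (real p) (real N)\<rfloor>. L f p m r * F f (nat \<lfloor>real N / real (p ^ r)\<rfloor>) 1)"
proof -
  define R where "R = nat \<lfloor>log (real p) (real N)\<rfloor>"
  have p: "p > 1"
    using assms(2) by (rule prime_gt_1_nat)
  \<comment> \<open>Since \<open>p ^ r dvd n\<close> forces \<open>p ^ r\<close> \<le>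
    \<open>N\<close>, the bound \<open>R\<close> excludes no exponent. It gives \<open>r\<close> a
    range independent of \<open>n\<close>, so that the two sums can be exchanged.\<close>
  have exps: "{0..multiplicity p n} = {r. r \<in> {0..R} \<and> p ^ r dvd n}" if "n \<in> {1..N}" for n
  proof -
    have "p ^ r dvd n \<longleftrightarrow> r \<le> multiplicity p n" for r
      using that p by (intro power_dvd_iff_le_multiplicity) auto
    moreover have "r \<le> R" if "p ^ r dvd n" for r
      unfolding R_def using \<open>n \<in> {1..N}\<close> that p
      by (intro le_nat_floor_log) (auto dest: dvd_imp_le)
    ultimately show ?thesis
      by auto
  qed
  have "F f N (p ^ m) = (\<Sum>n = 1..N. \<Sum>r | r \<in> {0..R} \<and> p ^ r dvd n. L f p m r * f (n div p ^ r))"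
    unfolding F_def
  proof (rule sum.cong[OF refl])
    fix n assume n: "n \<in> {1..N}"
    show "f (p ^ m * n) = (\<Sum>r | r \<in> {0..R} \<and> p ^ r dvd n. L f p m r * f (n div p ^ r))"
      using multiplicative_prime_power_expansion[OF assms(1,2), of n m] n
      unfolding exps[OF n] by simp
  qed
  also have "\<dots> = (\<Sum>r = 0..R. \<Sum>n | n \<in> {1..N} \<and> p ^ r dvd n. L f p m r * f (n div p ^ r))"
    by (rule sum.swap_restrict) simp_all
  also have "\<dots> = (\<Sum>r = 0..R. L f p m r * (\<Sum>n | n \<in> {1..N} \<and> p ^ r dvd n. f (n div p ^ r)))"
    by (simp only: sum_distrib_left)
  also have "\<dots> = (\<Sum>r = 0..R. L f p m r * (\<Sum>k = 1..N div p ^ r. f k))"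
    using p by (subst sum_over_multiples) simp_all
  \<comment> \<open>The floor of the real quotient is the natural-number quotient
    \<open>N div p ^ r\<close>.\<close>
  also have "\<dots> = (\<Sum>r = 0..R. L f p m r * F f (nat \<lfloor>real N / real (p ^ r)\<rfloor>) 1)"
    by (simp only: F_def floor_divide_of_nat_eq nat_int mult_1)
  finally show ?thesis
    by (simp only: R_def)
qed

end
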